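(* Let $R>0$, $N>1$, $x_0\in\mathbb{R}^2$, and let $g\colon[a,b]\to\mathbb{R}^2$ be an $R$-path with $g([a,b])\subset D\left(x_0,\frac{R}{2N}\right)$. Then $g$ can be reparametrized as an injective $R$-path, i.e. there exist an injective $R$-path $h\colon[\alpha,\beta]\to\mathbb{R}^2$ and a continuous nondecreasing surjection $f\colon[a,b]\to[\alpha,\beta]$ such that $g=h\circ f$.
   Context: Notation: $B(z,\rho)$ is the open disk in $\mathbb{R}^2$ of center $z$ and radius $\rho$, and $D(z,\rho)$ its closure. For a nonempty closed set $K\subset\mathbb{R}^2$ and $q\in K$, the tangent cone is $$\mathrm{Tan}(K,q)=\{v\in\mathbb{R}^2:\forall\varepsilon>0\ \exists x\in K,\ r>0\text{ with }|x-q|<\varepsilon,\ |r(x-q)-v|<\varepsilon\}.$$ $R$-path: let $R>0$. A continuous map $g\colon[a,b]\to\mathbb{R}^2$ with $g(a)\ne g(b)$ is an $R$-path if for every $t\in[a,b]$, writing $x=g(t)$, and for every unit vector $l\in\big[-\mathrm{Tan}(g([a,t]),x)\big]\cup\mathrm{Tan}(g([t,b]),x)$, one has $g([a,t])\cap B(x+Rl,R)=\varnothing$. *)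

theory Defs
  imports "HOL-Analysis.Analysis"
begin

definition Tan :: "(real^2) set \<Rightarrow> real^2 \<Rightarrow> (real^2) set" where
  "Tan K q = {v. \<forall>\<epsilon>>0. \<exists>x\<in>K. \<exists>r>0. norm (x - q) < \<epsilon> \<and> norm (r *\<^sub>R (x - q) - v) < \<epsilon>}"

text \<open>The conjunct \<open>a \<le> b\<close> says that \<open>{a..b}\<close> is a genuine interval; together with
  \<open>g a \<noteq> g b\<close> it gives \<open>a < b\<close>. Only the values of \<open>g\<close> on \<open>{a..b}\<close> matter.\<close>

definition R_path :: "real \<Rightarrow> real \<Rightarrow> real \<Rightarrow> (real \<Rightarrow> real^2) \<Rightarrow> bool" where
  "R_path R a b g \<longleftrightarrow>
     a \<le> b \<and> continuous_on {a..b} g \<and> g a \<noteq> g b \<and>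
     (\<forall>t\<in>{a..b}. \<forall>l \<in> uminus ` Tan (g ` {a..t}) (g t) \<union> Tan (g ` {t..b}) (g t).
        norm l = 1 \<longrightarrow> g ` {a..t} \<inter> ball (g t + R *\<^sub>R l) R = {})"

end

theory Submission
  imports Defs
begin

text \<open>
  The only real issue is that \<open>g s = g t\<close> forces \<open>g\<close> to be constant on \<open>[s,t]\<close>; a path whose
  fibres are intervals factors through its image, which is an arc. Suppose \<open>g\<close> leaves
  \<open>y = g s\<close> and returns to it at time \<open>t\<close>. Look at the last return at a scale \<open>d\<close> much smaller
  than \<open>R\<close>: there every tangent direction \<open>l\<close> at a point \<open>x\<close> satisfies
  \<open>(z - x) \<bullet> l \<le> |z - x|\<^sup>2 / (2 R)\<close>, almost \<open>\<le> 0\<close>, for each past point \<open>z\<close>. If \<open>P\<close> is the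
  last point at distance \<open>d\<close> from \<open>y\<close>, then the path stays in a narrow cone around the ray from
  \<open>y\<close> to \<open>P\<close>: otherwise \<open>y\<close>, \<open>P\<close> and a third past point span a fat triangle, and a tangent at
  a last exit from a suitable disk centred in this triangle would be almost orthogonal to two
  transversal sides. Inside the cone, the past points \<open>y\<close> and \<open>P\<close> on the two sides of \<open>x\<close>
  force all tangents to be almost orthogonal to the axis. But the path crosses from one end of
  the cone to the other, and at an extremum of a linear functional that is equal at both ends
  the incoming and outgoing tangents would be almost opposite, which is excluded because
  the past just before \<open>x\<close> lies in the direction opposite to the incoming tangent.

  No assumption of rectifiability enters: tangents are only evaluated at extremal times.
\<close>

section \<open>Tangent directions of connected plane sets\<close>

lemma Tan_mono: "A \<subseteq> B \<Longrightarrow> Tan A x \<subseteq> Tan B x"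
  unfolding Tan_def by blast

text \<open>Connectedness makes \<open>x\<close> a limit point of \<open>C\<close>, and compactness
  of the unit circle lets normalized differences subconverge. A quadratic bound divided by
  \<open>norm (z - x)\<close> has right side tending to 0, so the limit inherits a half-plane
  condition. A single \<open>l\<close> serves all \<open>n\<close> and \<open>c\<close>: later one
  tangent is tested against both a fixed vector and another tangent.\<close>

lemma tangent_exists:
  fixes C :: "(real^2) set"
  assumes "connected C" "x \<in> C" "z \<in> C" "z \<noteq> x"
  shows "\<exists>l \<in> Tan C x. norm l = 1 \<and>
    (\<forall>n c. (\<forall>z\<in>C. (z - x) \<bullet> n \<le> c * (norm (z - x))\<^sup>2) \<longrightarrow> l \<bullet> n \<le> 0)"
proof -
  have "x islimpt C"
    using assms connected_imp_perfect[of C x] by (metis singletonD)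
  then obtain q where q: "\<And>k. q k \<in> C - {x}" and qx: "q \<longlonglongrightarrow> x"
    unfolding islimpt_sequential by blast
  have "\<And>k. sgn (q k - x) \<in> sphere 0 1"
    using q by (auto simp: norm_sgn)
  moreover have "seq_compact (sphere (0::real^2) 1)"
    using compact_imp_seq_compact compact_sphere by blast
  ultimately obtain l r where l: "l \<in> sphere 0 1" and r: "strict_mono r"
    and lim: "((\<lambda>k. sgn (q k - x)) \<circ> r) \<longlonglongrightarrow> l"
    unfolding seq_compact_def by metis
  define p where "p = q \<circ> r"
  have p: "\<And>k. p k \<in> C" "\<And>k. p k \<noteq> x"
    using q unfolding p_def by auto
  have px: "p \<longlonglongrightarrow> x"
    unfolding p_def using qx r LIMSEQ_subseq_LIMSEQ by blast
  have lim': "(\<lambda>k. sgn (p k - x)) \<longlonglongrightarrow> l"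
    using lim unfolding p_def by (simp add: comp_def)
  have "l \<in> Tan C x"
    unfolding Tan_def mem_Collect_eq
  proof (intro allI impI)
    fix e :: real
    assume "e > 0"
    have "\<forall>\<^sub>F k in sequentially. dist (p k) x < e \<and> dist (sgn (p k - x)) l < e"
      using tendstoD[OF px \<open>e > 0\<close>] tendstoD[OF lim' \<open>e > 0\<close>] by (rule eventually_conj)
    then obtain k where "dist (p k) x < e" "dist (sgn (p k - x)) l < e"
      by (auto dest: eventually_happens)
    then have "norm (p k - x) < e" "norm (inverse (norm (p k - x)) *\<^sub>R (p k - x) - l) < e"
      "inverse (norm (p k - x)) > 0"
      using p(2)[of k] by (auto simp: dist_norm sgn_div_norm)
    then show "\<exists>x'\<in>C. \<exists>r>0. norm (x' - x) < e \<and> norm (r *\<^sub>R (x' - x) - l) < e"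
      using p(1)[of k] by blast
  qed
  moreover have "l \<bullet> n \<le> 0" if n: "\<forall>z\<in>C. (z - x) \<bullet> n \<le> c * (norm (z - x))\<^sup>2" for n c
  proof (rule LIMSEQ_le)
    show "(\<lambda>k. sgn (p k - x) \<bullet> n) \<longlonglongrightarrow> l \<bullet> n"
      by (intro tendsto_intros lim')
    have "(\<lambda>k. c * norm (p k - x)) \<longlonglongrightarrow> c * norm (x - x)"
      by (intro tendsto_intros px)
    then show "(\<lambda>k. c * norm (p k - x)) \<longlonglongrightarrow> 0"
      by simp
    have "sgn (p k - x) \<bullet> n \<le> c * norm (p k - x)" for k
    proof -
      have pos: "norm (p k - x) > 0"
        using p(2)[of k] by simp
      have "(p k - x) \<bullet> n \<le> c * (norm (p k - x))\<^sup>2"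
        using n p(1) by blast
      then have "(p k - x) \<bullet> n / norm (p k - x) \<le> c * norm (p k - x)"
        using pos by (simp add: divide_le_eq power2_eq_square mult.assoc)
      then show ?thesis
        by (simp add: sgn_div_norm divide_inverse mult.commute)
    qed
    then show "\<exists>N. \<forall>k\<ge>N. sgn (p k - x) \<bullet> n \<le> c * norm (p k - x)"
      by blast
  qed
  ultimately show ?thesis
    using l by auto
qed

section \<open>First and last passage times; frames of the plane\<close>

lemma last_level:
  fixes f :: "real \<Rightarrow> real"
  assumes "continuous_on {a..b} f" "a \<le> b" "f a \<ge> d" "f b \<le> d"
  shows "\<exists>u\<in>{a..b}. f u = d \<and> (\<forall>w\<in>{u..b}. f w \<le> d)"
proof -
  define S where "S = {u \<in> {a..b}. f u = d}"
  have "S \<noteq> {}"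
    using IVT2'[of f b d a] assms unfolding S_def by force
  moreover have "compact S"
    unfolding S_def using continuous_closed_preimage_constant[OF assms(1), of d]
      compact_Int_closed[of "{a..b}"] by (metis (mono_tags, lifting) Int_absorb1 closed_atLeastAtMost compact_Icc mem_Collect_eq subsetI)
  ultimately obtain u where u: "u \<in> S" "\<And>w. w \<in> S \<Longrightarrow> w \<le> u"
    using compact_attains_sup by metis
  \<comment> \<open>A value above \<open>d\<close> after \<open>u\<close> would, by the intermediate
    value theorem, force a later passage through \<open>d\<close>.\<close>
  have "f w \<le> d" if w: "w \<in> {u..b}" for w
  proof (rule ccontr)
    assume "\<not> f w \<le> d"
    moreover have "continuous_on {w..b} f"
      using assms(1) w u(1) unfolding S_def by (auto intro: continuous_on_subset)
    ultimately obtain v where v: "w \<le> v" "v \<le> b" "f v = d"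
      using IVT2'[of f b d w] assms(4) w by auto
    then have "v \<in> S"
      using u(1) w unfolding S_def by auto
    then have "v = w"
      using u(2) w v(1) by force
    then show False
      using \<open>\<not> f w \<le> d\<close> v by simp
  qed
  then show ?thesis
    using u(1) unfolding S_def by blast
qed

lemma first_level:
  fixes f :: "real \<Rightarrow> real"
  assumes "continuous_on {a..b} f" "a \<le> b" "f a \<ge> d" "f b \<le> d"
  shows "\<exists>u\<in>{a..b}. f u = d \<and> (\<forall>w\<in>{a..u}. f w \<ge> d)"
proof -
  have "continuous_on {-b..-a} (\<lambda>x. - f (- x))"
    by (intro continuous_intros continuous_on_compose2[OF assms(1)]) auto
  then obtain u where u: "u \<in> {-b..-a}" "f (-u) = d" "\<And>w. w \<in> {u..-a} \<Longrightarrow> f (-w) \<ge> d"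
    using last_level[of "-b" "-a" "\<lambda>x. - f (- x)" "-d"] assms by auto
  have "f w \<ge> d" if "w \<in> {a..-u}" for w
    using u(3)[of "-w"] that by simp
  then show ?thesis
    using u(1,2) by (intro bexI[of _ "-u"]) auto
qed

text \<open>The quarter turn: \<open>e\<close> and \<open>rot e\<close> form an orthonormal basis
  whenever \<open>e\<close> is a unit vector.\<close>

definition rot :: "real^2 \<Rightarrow> real^2" where
  "rot v = vector [- v $ 2, v $ 1]"

lemma inner_frame:
  assumes "norm e = 1"
  shows "z \<bullet> w = (z \<bullet> e) * (w \<bullet> e) + (z \<bullet> rot e) * (w \<bullet> rot e)"
proof -
  have "e $ 1 * e $ 1 + e $ 2 * e $ 2 = 1"
    using assms by (simp add: norm_eq_1 inner_vec_def sum_2)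
  then show ?thesis
    by (simp add: rot_def inner_vec_def sum_2) algebra
qed

section \<open>Loops with the empty-disk condition\<close>

text \<open>\<open>avoid\<close> is the condition that past points miss the open disk of radius
  \<open>R\<close> about \<open>g u + R *\<^sub>R l\<close>, squared and expanded with
  \<open>norm l = 1\<close>.\<close>

locale R_loop =
  fixes R s t :: real and g :: "real \<Rightarrow> real^2" and y :: "real^2"
  assumes R: "R > 0"
    and s_le_t: "s \<le> t"
    and cont: "continuous_on {s..t} g"
    and ends: "g s = y" "g t = y"
    and avoid: "\<And>u l w. \<lbrakk>u \<in> {s..t}; norm l = 1;
      l \<in> uminus ` Tan (g ` {s..u}) (g u) \<union> Tan (g ` {u..t}) (g u); w \<in> {s..u}\<rbrakk> \<Longrightarrow>
      2 * R * ((g w - g u) \<bullet> l) \<le> (norm (g w - g u))\<^sup>2"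
begin

text \<open>Tangency is forgotten and only the inequality kept, so that outgoing tangents and
  negated tangents to the past are treated alike.\<close>

definition clear :: "real \<Rightarrow> real^2 \<Rightarrow> bool" where
  "clear u l \<longleftrightarrow> norm l = 1 \<and>
    (\<forall>w\<in>{s..u}. 2 * R * ((g w - g u) \<bullet> l) \<le> (norm (g w - g u))\<^sup>2)"

lemma connected_piece: "s \<le> u \<Longrightarrow> v \<le> t \<Longrightarrow> connected (g ` {u..v})"
  by (intro connected_continuous_image continuous_on_subset[OF cont]) auto

lemma forward_tangent:
  assumes "s \<le> u" "u \<le> v" "v \<le> t" "g v \<noteq> g u"
  obtains l where "clear u l"
    "\<And>n c. (\<And>w. w \<in> {u..v} \<Longrightarrow> (g w - g u) \<bullet> n \<le> c * (norm (g w - g u))\<^sup>2) \<Longrightarrow> l \<bullet> n \<le> 0"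
proof -
  obtain l where l: "l \<in> Tan (g ` {u..v}) (g u)" "norm l = 1"
    "\<And>n c. \<forall>z\<in>g ` {u..v}. (z - g u) \<bullet> n \<le> c * (norm (z - g u))\<^sup>2 \<Longrightarrow> l \<bullet> n \<le> 0"
    using tangent_exists[OF connected_piece, of u v "g u" "g v"] assms by force
  moreover have "l \<in> Tan (g ` {u..t}) (g u)"
    using l(1) Tan_mono[of "g ` {u..v}" "g ` {u..t}"] assms by force
  moreover have "u \<in> {s..t}"
    using assms by simp
  ultimately show ?thesis
    using that[of l] avoid[of u l] unfolding clear_def by blast
qed

text \<open>A tangent to the past is negated to give the direction of travel, hence the reversed
  final inequality.\<close>

lemma backward_tangent:
  assumes "s \<le> v" "v \<le> u" "u \<le> t" "g v \<noteq> g u"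
  obtains l where "clear u l"
    "\<And>n c. (\<And>w. w \<in> {v..u} \<Longrightarrow> (g w - g u) \<bullet> n \<le> c * (norm (g w - g u))\<^sup>2) \<Longrightarrow> l \<bullet> n \<ge> 0"
proof -
  obtain l where l: "l \<in> Tan (g ` {v..u}) (g u)" "norm l = 1"
    "\<And>n c. \<forall>z\<in>g ` {v..u}. (z - g u) \<bullet> n \<le> c * (norm (z - g u))\<^sup>2 \<Longrightarrow> l \<bullet> n \<le> 0"
    using tangent_exists[OF connected_piece, of v u "g u" "g v"] assms by force
  moreover have "- l \<in> uminus ` Tan (g ` {s..u}) (g u)"
    using l(1) Tan_mono[of "g ` {v..u}" "g ` {s..u}"] assms by force
  moreover have "u \<in> {s..t}" "norm (- l) = 1"
    using assms l(2) by simp_all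
  moreover have "- l \<bullet> n \<ge> 0"
    if "\<And>w. w \<in> {v..u} \<Longrightarrow> (g w - g u) \<bullet> n \<le> c * (norm (g w - g u))\<^sup>2" for n c
    using l(3)[of n c] that by simp
  ultimately show ?thesis
    using that[of "- l"] avoid[of u "- l"] unfolding clear_def by blast
qed

section \<open>Extrema of linear functionals along a loop\<close>

text \<open>At an interior maximum \<open>m\<close> of the functional the outgoing tangent does not
  increase it and the incoming one does not decrease it, so \<open>opposite\<close> applies to them.
  The past, however, forbids a negative product.\<close>

lemma no_peak:
  assumes pq: "s \<le> p" "p \<le> q" "q \<le> t"
    and eq: "g p \<bullet> v = g q \<bullet> v"
    and u: "u \<in> {p..q}" "g u \<bullet> v > g p \<bullet> v"
    and opposite: "\<And>u l l'. \<lbrakk>u \<in> {p..q}; clear u l; clear u l';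
      l \<bullet> v \<le> 0; l' \<bullet> v \<ge> 0\<rbrakk> \<Longrightarrow> l \<bullet> l' < 0"
  shows False
proof -
  have "continuous_on {p..q} (\<lambda>u. g u \<bullet> v)"
    using pq by (intro continuous_intros continuous_on_subset[OF cont]) auto
  then obtain m where m: "m \<in> {p..q}" "\<And>w. w \<in> {p..q} \<Longrightarrow> g w \<bullet> v \<le> g m \<bullet> v"
    using continuous_attains_sup[of "{p..q}" "\<lambda>u. g u \<bullet> v"] pq(2) by fastforce
  have gm: "g m \<bullet> v > g p \<bullet> v"
    using m(2)[OF u(1)] u(2) by simp
  then have "g p \<noteq> g m" "g q \<noteq> g m"
    using eq by auto
  obtain l where l: "clear m l"
    "\<And>n c. (\<And>w. w \<in> {m..q} \<Longrightarrow> (g w - g m) \<bullet> n \<le> c * (norm (g w - g m))\<^sup>2) \<Longrightarrow> l \<bullet> n \<le> 0"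
    using forward_tangent[of m q] m(1) pq \<open>g q \<noteq> g m\<close> by auto
  obtain l' where l': "clear m l'"
    "\<And>n c. (\<And>w. w \<in> {p..m} \<Longrightarrow> (g w - g m) \<bullet> n \<le> c * (norm (g w - g m))\<^sup>2) \<Longrightarrow> l' \<bullet> n \<ge> 0"
    using backward_tangent[of p m] m(1) pq \<open>g p \<noteq> g m\<close> by auto
  have "l \<bullet> v \<le> 0"
    using l(2)[of v 0] m by (simp add: inner_diff_left)
  moreover have "l' \<bullet> v \<ge> 0"
    using l'(2)[of v 0] m by (simp add: inner_diff_left)
  ultimately have "l \<bullet> l' < 0"
    using opposite[of m l l'] m(1) l(1) l'(1) by blast
  \<comment> \<open>Clearness of the outgoing \<open>l\<close> is itself a quadratic bound on the
    past with \<open>c = 1 / (2 * R)\<close>, so the incoming \<open>l'\<close> can be tested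
    against \<open>n = l\<close>.\<close>
  moreover have "l' \<bullet> l \<ge> 0"
  proof (rule l'(2)[of l "1 / (2 * R)"])
    fix w
    assume "w \<in> {p..m}"
    then have "2 * R * ((g w - g m) \<bullet> l) \<le> (norm (g w - g m))\<^sup>2"
      using l(1) pq(1) unfolding clear_def by simp
    then show "(g w - g m) \<bullet> l \<le> 1 / (2 * R) * (norm (g w - g m))\<^sup>2"
      using R by (simp add: field_simps)
  qed
  ultimately show False
    by (simp add: inner_commute)
qed

text \<open>Applying \<open>no_peak\<close> to \<open>v\<close> and, with the two tangents
  exchanged, to \<open>- v\<close> makes the functional constant. A forward tangent at
  \<open>p\<close> is then orthogonal to \<open>v\<close> and plays both roles in
  \<open>opposite\<close>, which gives \<open>l \<bullet> l < 0\<close>.\<close>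

lemma no_chord:
  assumes pq: "s \<le> p" "p \<le> q" "q \<le> t"
    and ne: "g p \<noteq> g q"
    and eq: "g p \<bullet> v = g q \<bullet> v"
    and opposite: "\<And>u l l'. \<lbrakk>u \<in> {p..q}; clear u l; clear u l';
      l \<bullet> v \<le> 0; l' \<bullet> v \<ge> 0\<rbrakk> \<Longrightarrow> l \<bullet> l' < 0"
  shows False
proof -
  have "\<not> g u \<bullet> v > g p \<bullet> v" if "u \<in> {p..q}" for u
    using no_peak[OF pq eq that] opposite by blast
  moreover have "\<not> g u \<bullet> v < g p \<bullet> v" if "u \<in> {p..q}" for u
  proof
    assume "g u \<bullet> v < g p \<bullet> v"
    then show False
    proof (intro no_peak[OF pq, of "- v" u])
      fix u l l'
      assume "u \<in> {p..q}" "clear u l" "clear u l'" "l \<bullet> - v \<le> 0" "0 \<le> l' \<bullet> - v"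
      then show "l \<bullet> l' < 0"
        using opposite[of u l' l] by (simp add: inner_commute)
    qed (use eq that in auto)
  qed
  ultimately have const: "g u \<bullet> v = g p \<bullet> v" if "u \<in> {p..q}" for u
    using that by (meson linorder_neqE_linordered_idom)
  obtain l where l: "clear p l"
    "\<And>n c. (\<And>w. w \<in> {p..q} \<Longrightarrow> (g w - g p) \<bullet> n \<le> c * (norm (g w - g p))\<^sup>2) \<Longrightarrow> l \<bullet> n \<le> 0"
    using forward_tangent[of p q] pq ne by auto
  have "(g w - g p) \<bullet> v = 0" if "w \<in> {p..q}" for w
    using const[OF that] by (simp add: inner_diff_left)
  then have "l \<bullet> v \<le> 0" "l \<bullet> v \<ge> 0"
    using l(2)[of v 0] l(2)[of "- v" 0] by simp_all
  moreover have "p \<in> {p..q}"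
    using pq by simp
  ultimately have "l \<bullet> l < 0"
    using opposite l(1) by blast
  then show False
    using inner_ge_zero[of l] by linarith
qed

text \<open>The angle \<open>arccos (24/25)\<close> is a small one with rational sine \<open>7/25\<close>; the factor
  \<open>10000\<close> is generous.\<close>

lemma no_wide_triangle:
  assumes u1: "s \<le> u1" "u1 \<le> w" "w \<le> t"
    and d: "d > 0" "10000 * d \<le> R"
    and P: "norm (g u1 - y) = d"
    and near: "\<And>u. u \<in> {u1..t} \<Longrightarrow> norm (g u - y) \<le> d"
    and Q: "norm (g w - y) \<ge> d / 4"
    and angle: "(g u1 - y) \<bullet> (g w - y) = 24/25 * d * norm (g w - y)"
  shows False
proof -
  define P where "P = g u1 - y"
  define Q where "Q = g w - y"
  define h where "h = norm Q"
  \<comment> \<open>A point of the triangle with all barycentric weights bounded below and, as \<open>d \<le> 4 * h\<close>,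
    closer to \<open>y\<close> than to \<open>g w\<close>.\<close>
  define z where "z = y + (1/32) *\<^sub>R P + (1/4) *\<^sub>R Q"
  have h: "d \<le> 4 * h" "h > 0" "h \<le> d" and nP: "norm P = d"
    using Q d P near[of w] u1 unfolding h_def Q_def P_def by auto
  have PQ: "P \<bullet> Q = 24/25 * d * h"
    using angle unfolding P_def Q_def h_def .
  have closer: "norm (y - z) < norm (g w - z)"
  proof -
    define V where "V = (1/32) *\<^sub>R P + (1/4) *\<^sub>R Q"
    have "(norm (Q - V))\<^sup>2 = (norm V)\<^sup>2 + h\<^sup>2 - 2 * (Q \<bullet> V)"
      unfolding h_def power2_norm_eq_inner by (simp add: inner_diff_left inner_diff_right inner_commute)
    also have "Q \<bullet> V = 24/25 * d * h / 32 + h\<^sup>2 / 4"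
      using PQ unfolding V_def h_def power2_norm_eq_inner by (simp add: inner_add_right inner_commute)
    also have "(norm V)\<^sup>2 + h\<^sup>2 - 2 * (24/25 * d * h / 32 + h\<^sup>2 / 4) > (norm V)\<^sup>2"
    proof -
      have "d * h \<le> 4 * h * h"
        using h by (intro mult_right_mono) auto
      moreover have "h * h > 0"
        using h by simp
      ultimately have "3 * (d * h) < h * h * 25"
        by linarith
      then show ?thesis
        by (simp add: power2_eq_square)
    qed
    finally have "norm V < norm (Q - V)"
      using power2_less_imp_less norm_ge_zero by blast
    moreover have "y - z = - V" "g w - z = Q - V"
      unfolding z_def V_def Q_def by auto
    ultimately show ?thesis
      by simp
  qed
  \<comment> \<open>The path ends at \<open>y\<close>, strictly inside the circle about
    \<open>z\<close> through \<open>g w\<close>. At its last time \<open>u\<close> on this circle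
    the forward tangent cannot point outward; this is \<open>lz\<close> below.\<close>
  have "continuous_on {w..t} (\<lambda>u. norm (g u - z))"
    using u1 by (intro continuous_intros continuous_on_subset[OF cont]) auto
  then obtain u where u: "u \<in> {w..t}" "norm (g u - z) = norm (g w - z)"
    "\<And>v. v \<in> {u..t} \<Longrightarrow> norm (g v - z) \<le> norm (g w - z)"
    using last_level[of w t "\<lambda>u. norm (g u - z)" "norm (g w - z)", OF _ u1(3)] closer ends(2)
    by auto
  have "g t \<noteq> g u"
    using u(2) closer ends by auto
  then obtain l where l: "clear u l"
    "\<And>n c. (\<And>w. w \<in> {u..t} \<Longrightarrow> (g w - g u) \<bullet> n \<le> c * (norm (g w - g u))\<^sup>2) \<Longrightarrow> l \<bullet> n \<le> 0"
    using forward_tangent[of u t] u1 u(1) by auto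
  define x where "x = (g u - y) \<bullet> l"
  have lz: "l \<bullet> (g u - z) \<le> 0"
  proof (rule l(2)[of _ 0])
    fix v
    assume "v \<in> {u..t}"
    then have "norm (g v - z) \<le> norm (g u - z)"
      using u by simp
    then have "(g v - z) \<bullet> (g u - z) \<le> (norm (g u - z))\<^sup>2"
      using norm_cauchy_schwarz[of "g v - z" "g u - z"]
        mult_right_mono[of "norm (g v - z)" "norm (g u - z)" "norm (g u - z)"]
      by (simp add: power2_eq_square)
    then have "((g v - z) - (g u - z)) \<bullet> (g u - z) \<le> 0"
      by (simp only: inner_diff_left[of "g v - z" "g u - z"] power2_norm_eq_inner diff_le_0_iff_le)
    then show "(g v - g u) \<bullet> (g u - z) \<le> 0 * (norm (g v - g u))\<^sup>2"
      by simp
  qed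
  have "l \<bullet> (g u - z) = x - P \<bullet> l / 32 - Q \<bullet> l / 4"
    unfolding z_def x_def
    by (simp add: inner_diff_right inner_diff_left inner_add_right inner_commute)
  then have lin: "x - P \<bullet> l / 32 - Q \<bullet> l / 4 \<le> 0"
    using lz by simp
  \<comment> \<open>Both points lie within \<open>d\<close> of \<open>y\<close>, so clearness bounds
    the product by \<open>(2 * d)\<^sup>2 / (2 * R)\<close>, and
    \<open>10000 * d \<le> R\<close>.\<close>
  have bound: "(g v - g u) \<bullet> l \<le> d / 5000" if "v \<in> {s..u}" "norm (g v - y) \<le> d" for v
  proof -
    have "norm (g v - g u) \<le> norm (g v - y) + norm (g u - y)"
      using norm_triangle_ineq4[of "g v - y" "g u - y"] by simp
    also have "\<dots> \<le> 2 * d"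
      using that(2) near[of u] u u1 by simp
    finally have "(norm (g v - g u))\<^sup>2 \<le> (2 * d)\<^sup>2"
      by (intro power_mono) auto
    moreover have "2 * R * ((g v - g u) \<bullet> l) \<le> (norm (g v - g u))\<^sup>2"
      using l(1) that(1) unfolding clear_def by blast
    ultimately have "2 * R * ((g v - g u) \<bullet> l) \<le> 4 * (d * d)"
      by (simp add: power2_eq_square)
    also have "d * d \<le> d * (R / 10000)"
      using d by (intro mult_left_mono) auto
    finally have "R * ((g v - g u) \<bullet> l) \<le> R * (d / 5000)"
      by (simp add: mult.commute)
    then show ?thesis
      using R by simp
  qed
  have sub: "g v - g u = (g v - y) - (g u - y)" for v
    by simp
  have b0: "- x \<le> d / 5000"
    using bound[of s] u u1 ends(1) d(1) unfolding sub[of s] x_def inner_diff_left[of "g s - y"] by simp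
  have bP: "P \<bullet> l - x \<le> d / 5000"
    using bound[of u1] u u1 P unfolding sub[of u1] x_def P_def inner_diff_left[of "g u1 - y"] by simp
  have bQ: "Q \<bullet> l - x \<le> d / 5000"
    using bound[of w] u u1 near[of w] unfolding sub[of w] x_def Q_def inner_diff_left[of "g w - y"] by simp
  \<comment> \<open>By \<open>lin\<close>, the mean of \<open>- x\<close>,
    \<open>P \<bullet> l - x\<close> and \<open>Q \<bullet> l - x\<close> with the barycentric
    weights 23/32, 1/32, 1/4 of \<open>z\<close> is nonnegative, while each is at most
    \<open>d / 5000\<close>. Hence none is very negative; 32 and 4 are reciprocals of
    weights.\<close>
  have pl: "\<bar>P \<bullet> l\<bar> \<le> 32 * (d / 5000)" and ql: "\<bar>Q \<bullet> l\<bar> \<le> 4 * (d / 5000)"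
    using b0 bP bQ lin d(1) by linarith+
  \<comment> \<open>In this frame \<open>P\<close> controls the first coordinate of
    \<open>l\<close>; \<open>Q\<close>, with transverse part \<open>7/25 * h\<close>, then controls
    the second. Both turn out too small for a unit vector.\<close>
  define e where "e = (1 / d) *\<^sub>R P"
  have e: "norm e = 1"
    unfolding e_def using nP d by simp
  define l1 where "l1 = l \<bullet> e"
  define l2 where "l2 = l \<bullet> rot e"
  define q where "q = Q \<bullet> rot e"
  have l1: "\<bar>l1\<bar> \<le> 32 / 5000"
    using pl d unfolding l1_def e_def by (simp add: inner_commute field_simps abs_mult)
  have Qe: "Q \<bullet> e = 24/25 * h"
    using PQ d unfolding e_def by (simp add: inner_commute)
  have "h\<^sup>2 = (24/25 * h)\<^sup>2 + q\<^sup>2"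
    using inner_frame[OF e, of Q Q] unfolding Qe
    by (simp only: h_def q_def power2_norm_eq_inner) (simp add: power2_eq_square)
  moreover have Ql: "Q \<bullet> l = 24/25 * h * l1 + q * l2"
    using inner_frame[OF e, of Q l] unfolding Qe q_def l1_def l2_def .
  ultimately have "q\<^sup>2 = (7/25 * h)\<^sup>2"
    by (simp add: power2_eq_square)
  then have "q = 7/25 * h \<or> q = - (7/25 * h)"
    by (simp only: power2_eq_iff)
  then have q: "\<bar>q\<bar> = 7/25 * h"
    using h(2) by auto
  have q_l2: "q * l2 = Q \<bullet> l - 24/25 * (h * l1)"
    using Ql by simp
  have "\<bar>h * l1\<bar> \<le> h * (32 / 5000)"
    using l1 h by (simp add: abs_mult)
  then have "\<bar>q * l2\<bar> \<le> h * (48 / 5000)"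
    using ql h(1) unfolding q_l2 abs_le_iff by linarith
  then have "h * (7/25 * \<bar>l2\<bar>) \<le> h * (48 / 5000)"
    unfolding abs_mult q by (simp add: mult.assoc mult.left_commute)
  then have "\<bar>l2\<bar> \<le> 1/2"
    using h by simp
  then have "l2\<^sup>2 \<le> (1/2)\<^sup>2" "l1\<^sup>2 \<le> (1/2)\<^sup>2"
    using l1 by (simp_all only: abs_le_square_iff[symmetric])
  moreover have "l1\<^sup>2 + l2\<^sup>2 = 1"
    using inner_frame[OF e, of l l] l(1) unfolding l1_def l2_def clear_def norm_eq_1 by (simp add: power2_eq_square)
  ultimately show False
    by (simp add: power2_eq_square)
qed

section \<open>Loops are constant\<close>

lemma loop_constant:
  assumes v: "v \<in> {s..t}"
  shows "g v = y"
proof (rule ccontr)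
  assume ne: "g v \<noteq> y"
  define \<rho> where "\<rho> = (\<lambda>u. norm (g u - y))"
  \<comment> \<open>Small against \<open>R\<close>, yet at most the distance at time
    \<open>v\<close>, so that the path passes distance \<open>d\<close> after
    \<open>v\<close>.\<close>
  define d where "d = min (norm (g v - y)) (R / 10000)"
  have d: "d > 0" "10000 * d \<le> R" "d \<le> \<rho> v"
    using ne R unfolding d_def \<rho>_def by auto
  have c\<rho>: "continuous_on {a..b} \<rho>" if "s \<le> a" "b \<le> t" for a b
    unfolding \<rho>_def using that by (intro continuous_intros continuous_on_subset[OF cont]) auto
  have \<rho>t: "\<rho> t = 0"
    unfolding \<rho>_def ends by simp
  \<comment> \<open>The times are ordered \<open>u1 \<le> u3 \<le> u2\<close>. On
    \<open>{u3..u2}\<close> the path crosses inward from distance \<open>d / 2\<close> to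
    \<open>d / 4\<close>, so both \<open>y\<close> and \<open>g u1\<close> are past points at
    distance comparable to \<open>d\<close>.\<close>
  obtain u1 where u1: "u1 \<in> {v..t}" "\<rho> u1 = d" "\<And>u. u \<in> {u1..t} \<Longrightarrow> \<rho> u \<le> d"
    using last_level[OF c\<rho>, of v t d] v d \<rho>t by auto
  obtain u2 where u2: "u2 \<in> {u1..t}" "\<rho> u2 = d / 4" "\<And>u. u \<in> {u1..u2} \<Longrightarrow> \<rho> u \<ge> d / 4"
    using first_level[OF c\<rho>, of u1 t "d / 4"] v d u1 \<rho>t by auto
  obtain u3 where u3: "u3 \<in> {u1..u2}" "\<rho> u3 = d / 2" "\<And>u. u \<in> {u3..u2} \<Longrightarrow> \<rho> u \<le> d / 2"
    using last_level[OF c\<rho>, of u1 u2 "d / 2"] v d u1 u2 by auto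
  define P where "P = g u1 - y"
  have nP: "norm P = d"
    using u1(2) unfolding P_def \<rho>_def .
  \<comment> \<open>Leaving the cone means meeting its boundary at some time \<open>w\<close>, where
    the angle is exactly the one excluded by \<open>no_wide_triangle\<close>; \<open>f\<close>
    measures the position relative to that boundary.\<close>
  have cone: "P \<bullet> (g u - y) \<ge> 24/25 * d * \<rho> u" if u: "u \<in> {u1..u2}" for u
  proof (rule ccontr)
    assume neg: "\<not> P \<bullet> (g u - y) \<ge> 24/25 * d * \<rho> u"
    define f where "f = (\<lambda>u. P \<bullet> (g u - y) - 24/25 * d * \<rho> u)"
    have "continuous_on {u1..u} f"
      unfolding f_def using u v u1 u2
      by (intro continuous_intros c\<rho> continuous_on_subset[OF cont]) auto
    moreover have "P \<bullet> P = d * d"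
      using nP by (metis power2_norm_eq_inner power2_eq_square)
    then have "f u1 \<ge> 0"
      unfolding f_def u1(2) P_def[symmetric] using d(1) by simp
    moreover have "f u \<le> 0"
      using neg unfolding f_def by simp
    ultimately obtain w where w: "w \<in> {u1..u}" "f w = 0"
      using last_level[of u1 u f 0] u by auto
    show False
    proof (rule no_wide_triangle[of u1 w d])
      show "(g u1 - y) \<bullet> (g w - y) = 24/25 * d * norm (g w - y)"
        using w(2) unfolding f_def P_def \<rho>_def by simp
    qed (use w u u1 u2 v d in \<open>auto simp: \<rho>_def\<close>)
  qed
  define e where "e = (1 / d) *\<^sub>R P"
  have e: "norm e = 1"
    unfolding e_def using nP d by simp
  have P_inner: "P \<bullet> l = d * (l \<bullet> e)" for l
    unfolding e_def using d by (simp add: inner_commute)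
  have radial_ge: "24/25 * \<rho> u \<le> (g u - y) \<bullet> e" if u: "u \<in> {u1..u2}" for u
  proof -
    have "d * (24/25 * \<rho> u) \<le> d * ((g u - y) \<bullet> e)"
      using cone[OF u] unfolding P_inner by (simp add: mult_ac)
    then show ?thesis
      using d(1) by simp
  qed
  have radial_le: "(g u - y) \<bullet> e \<le> \<rho> u" for u
    using norm_cauchy_schwarz[of "g u - y" e] e unfolding \<rho>_def by simp
  have lateral_le: "\<bar>(g u - y) \<bullet> rot e\<bar> \<le> 7/25 * \<rho> u" if u: "u \<in> {u1..u2}" for u
  proof -
    have "(\<rho> u)\<^sup>2 = ((g u - y) \<bullet> e)\<^sup>2 + ((g u - y) \<bullet> rot e)\<^sup>2"
      using inner_frame[OF e, of "g u - y" "g u - y"]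
      unfolding \<rho>_def power2_norm_eq_inner by (simp add: power2_eq_square)
    moreover have "(24/25 * \<rho> u)\<^sup>2 \<le> ((g u - y) \<bullet> e)\<^sup>2"
      using radial_ge[OF u] by (intro power_mono) (auto simp: \<rho>_def)
    ultimately have "((g u - y) \<bullet> rot e)\<^sup>2 \<le> (7/25 * \<rho> u)\<^sup>2"
      by (simp add: power2_eq_square)
    then have "\<bar>(g u - y) \<bullet> rot e\<bar> \<le> \<bar>7/25 * \<rho> u\<bar>"
      by (simp only: abs_le_square_iff)
    then show ?thesis
      by (simp add: \<rho>_def)
  qed
  have steep: "\<bar>l \<bullet> e\<bar> < \<bar>l \<bullet> rot e\<bar>"
    if u: "u \<in> {u3..u2}" and "clear u l" for u l
  proof -
    have l: "norm l = 1"
      and past: "\<And>w. w \<in> {s..u} \<Longrightarrow> 2 * R * ((g w - g u) \<bullet> l) \<le> (norm (g w - g u))\<^sup>2"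
      using that(2) unfolding clear_def by auto
    define X where "X = g u - y"
    define r where "r = \<rho> u"
    define x1 where "x1 = X \<bullet> e"
    define x2 where "x2 = X \<bullet> rot e"
    define l1 where "l1 = l \<bullet> e"
    define l2 where "l2 = l \<bullet> rot e"
    have u': "u \<in> {u1..u2}"
      using u u3 by auto
    have r: "d / 4 \<le> r" "r \<le> d / 2" "r > 0" "norm X = r"
      using u2(3)[OF u'] u3(3)[OF u] d(1) unfolding r_def \<rho>_def X_def by auto
    have x: "24/25 * r \<le> x1" "x1 \<le> r" "\<bar>x2\<bar> \<le> 7/25 * r"
      using radial_ge[OF u'] radial_le[of u] lateral_le[OF u'] unfolding r_def x1_def x2_def X_def by auto
    have Xl: "X \<bullet> l = x1 * l1 + x2 * l2"
      unfolding x1_def x2_def l1_def l2_def by (rule inner_frame[OF e])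
    have unit: "l1\<^sup>2 + l2\<^sup>2 = 1"
      using inner_frame[OF e, of l l] l unfolding l1_def l2_def norm_eq_1 by (simp add: power2_eq_square)
    then have "l2\<^sup>2 \<le> 1\<^sup>2"
      using zero_le_power2[of l1] unfolding one_power2 by linarith
    then have l2: "\<bar>l2\<bar> \<le> 1"
      by (simp only: abs_le_square_iff[symmetric] abs_one)
    then have x2l2: "\<bar>x2 * l2\<bar> \<le> 7/25 * r"
      using x(3) mult_mono[of "\<bar>x2\<bar>" "7/25 * r" "\<bar>l2\<bar>" 1] r by (simp add: abs_mult)
    \<comment> \<open>The past point \<open>y\<close> lies behind along the axis. A backward slope
      beyond 2/5 outweighs the lateral term, since \<open>24/25 * 2/5 - 7/25\<close> exceeds 1/10,
      and violates clearness.\<close>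
    have "l1 \<ge> - (2/5)"
    proof (rule ccontr)
      assume "\<not> l1 \<ge> - (2/5)"
      then have "x1 * l1 \<le> x1 * (- (2/5))"
        using x r by (intro mult_left_mono) auto
      then have "- (X \<bullet> l) \<ge> r / 10"
        using Xl x2l2 x(1) r(3) by (simp add: abs_le_iff)
      have "- (2 * R * (X \<bullet> l)) \<le> r * r"
        using past[of s] u u3 u1 v ends(1) r(4) unfolding X_def
        by (simp add: power2_eq_square norm_minus_commute inner_diff_left algebra_simps)
      moreover have "2 * R * (r / 10) \<le> 2 * R * (- (X \<bullet> l))"
        using \<open>- (X \<bullet> l) \<ge> r / 10\<close> R by (intro mult_left_mono) auto
      ultimately have "2 * R * (r / 10) \<le> r * r"
        by linarith
      then have "r * (R / 5) \<le> r * r"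
        by (simp add: mult.commute)
      then have "R / 5 \<le> r"
        using r(3) by simp
      then show False
        using r d R by linarith
    qed
    \<comment> \<open>Symmetrically, \<open>P\<close> lies ahead by at least \<open>d / 2\<close>
      along the axis, and \<open>d / 5 - 7/50 * d\<close> exceeds \<open>d / 20\<close>.\<close>
    moreover have "l1 \<le> 2/5"
    proof (rule ccontr)
      assume l1: "\<not> l1 \<le> 2/5"
      have "d / 2 * (2/5) \<le> (d - x1) * l1"
        using x r l1 d by (intro mult_mono) auto
      then have "(P - X) \<bullet> l \<ge> d / 20"
        using x2l2 r d(1) by (simp add: inner_diff_left P_inner Xl l1_def[symmetric] algebra_simps abs_le_iff)
      have "norm (P - X) \<le> 2 * d"
        using norm_triangle_ineq4[of P X] nP r d(1) by simp
      then have "(norm (P - X))\<^sup>2 \<le> (2 * d)\<^sup>2"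
        by (intro power_mono) auto
      then have "2 * R * ((P - X) \<bullet> l) \<le> 4 * (d * d)"
        using past[of u1] u u3 u1 v unfolding X_def P_def by (simp add: power2_eq_square)
      moreover have "2 * R * (d / 20) \<le> 2 * R * ((P - X) \<bullet> l)"
        using \<open>(P - X) \<bullet> l \<ge> d / 20\<close> R by (intro mult_left_mono) auto
      ultimately have "d * (R / 10) \<le> d * (4 * d)"
        by (simp add: mult_ac)
      then show False
        using d by simp
    qed
    ultimately have "\<bar>l1\<bar> \<le> \<bar>2/5\<bar>"
      by simp
    then have "l1\<^sup>2 \<le> (2/5)\<^sup>2"
      by (simp only: abs_le_square_iff)
    then have "l1\<^sup>2 < l2\<^sup>2"
      using unit by (simp add: power2_eq_square)
    then show ?thesis
      unfolding l1_def l2_def using abs_le_square_iff by (meson not_le)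
  qed
  define c1 where "c1 = (g u3 - g u2) \<bullet> e"
  define c2 where "c2 = (g u3 - g u2) \<bullet> rot e"
  \<comment> \<open>The chord from \<open>g u2\<close> to \<open>g u3\<close> turned by a right
    angle, so the functional agrees at both ends.\<close>
  define n where "n = c1 *\<^sub>R rot e - c2 *\<^sub>R e"
  have "g u3 - g u2 = (g u3 - y) - (g u2 - y)"
    by simp
  then have "c1 = (g u3 - y) \<bullet> e - (g u2 - y) \<bullet> e"
    "c2 = (g u3 - y) \<bullet> rot e - (g u2 - y) \<bullet> rot e"
    unfolding c1_def c2_def by (simp_all only: inner_diff_left[symmetric])
  moreover have "u2 \<in> {u1..u2}"
    using u2(1) by simp
  \<comment> \<open>The radii \<open>d / 2\<close> and \<open>d / 4\<close> give
    \<open>c1 \<ge> 23/100 * d\<close> and \<open>\<bar>c2\<bar> \<le> 21/100 * d\<close>: the chord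
    is within 45 degrees of the axis.\<close>
  ultimately have c: "\<bar>c2\<bar> \<le> c1" "c1 > 0"
    using radial_ge[OF u3(1)] radial_le[of u2] lateral_le[OF u3(1)] lateral_le[of u2] d(1)
    unfolding u3(2) u2(2) by linarith+
  have ln: "l \<bullet> n = c1 * (l \<bullet> rot e) - c2 * (l \<bullet> e)" for l
    unfolding n_def by (simp add: inner_diff_right)
  show False
  proof (rule no_chord[of u3 u2 n])
    show "s \<le> u3" "u3 \<le> u2" "u2 \<le> t"
      using v u1 u2 u3 by auto
    show "g u3 \<noteq> g u2"
      using u3(2) u2(2) d(1) unfolding \<rho>_def by auto
    have "(g u3 - g u2) \<bullet> n = 0"
      unfolding ln c1_def c2_def by simp
    then show "g u3 \<bullet> n = g u2 \<bullet> n"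
      by (simp add: inner_diff_left)
  next
    fix u l l'
    assume u: "u \<in> {u3..u2}" and l: "clear u l" "clear u l'"
      and sgn: "l \<bullet> n \<le> 0" "l' \<bullet> n \<ge> 0"
    have st: "\<bar>l \<bullet> e\<bar> < \<bar>l \<bullet> rot e\<bar>" "\<bar>l' \<bullet> e\<bar> < \<bar>l' \<bullet> rot e\<bar>"
      using steep[OF u l(1)] steep[OF u l(2)] by auto
    \<comment> \<open>For steep vectors the second term of \<open>ln\<close> is dominated, so the
      sign of \<open>m \<bullet> n\<close> is that of \<open>m \<bullet> rot e\<close>.\<close>
    have small: "\<bar>c2 * (m \<bullet> e)\<bar> < c1 * \<bar>m \<bullet> rot e\<bar>" if "\<bar>m \<bullet> e\<bar> < \<bar>m \<bullet> rot e\<bar>" for m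
    proof -
      have "\<bar>c2\<bar> * \<bar>m \<bullet> e\<bar> \<le> c1 * \<bar>m \<bullet> e\<bar>"
        using c by (intro mult_right_mono) auto
      also have "\<dots> < c1 * \<bar>m \<bullet> rot e\<bar>"
        using c that by simp
      finally show ?thesis
        by (simp add: abs_mult)
    qed
    have "l \<bullet> rot e < 0"
    proof (rule ccontr)
      assume "\<not> l \<bullet> rot e < 0"
      then show False
        using small[OF st(1)] sgn(1) unfolding ln by (simp add: abs_if split: if_splits)
    qed
    moreover have "l' \<bullet> rot e > 0"
    proof (rule ccontr)
      assume "\<not> l' \<bullet> rot e > 0"
      then show False
        using small[OF st(2)] sgn(2) unfolding ln by (auto simp: abs_if split: if_splits)
    qed
    moreover have "\<bar>(l \<bullet> e) * (l' \<bullet> e)\<bar> < \<bar>(l \<bullet> rot e)\<bar> * \<bar>(l' \<bullet> rot e)\<bar>"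
      unfolding abs_mult using st by (intro mult_strict_mono') auto
    ultimately show "l \<bullet> l' < 0"
      unfolding inner_frame[OF e, of l l'] by (simp add: abs_if split: if_splits)
  qed
qed

end

text \<open>Passing to \<open>{s..t}\<close> shrinks both the tangent cones and the past, so the
  empty-disk condition survives; squaring it yields \<open>avoid\<close>.\<close>

lemma R_path_constant_between:
  assumes "R > 0" "R_path R a b g" "a \<le> s" "s \<le> u" "u \<le> t" "t \<le> b" "g s = g t"
  shows "g u = g s"
proof -
  interpret R_loop R s t g "g s"
  proof
    show "continuous_on {s..t} g"
      using assms unfolding R_path_def by (auto intro: continuous_on_subset)
    fix u l w
    assume u: "u \<in> {s..t}" and l: "norm l = 1"
      "l \<in> uminus ` Tan (g ` {s..u}) (g u) \<union> Tan (g ` {u..t}) (g u)" and w: "w \<in> {s..u}"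
    have "Tan (g ` {s..u}) (g u) \<subseteq> Tan (g ` {a..u}) (g u)"
      "Tan (g ` {u..t}) (g u) \<subseteq> Tan (g ` {u..b}) (g u)"
      using assms by (intro Tan_mono image_mono; auto)+
    then have "l \<in> uminus ` Tan (g ` {a..u}) (g u) \<union> Tan (g ` {u..b}) (g u)"
      using l(2) by blast
    moreover have "u \<in> {a..b}" "w \<in> {a..u}"
      using u w assms by auto
    ultimately have "g w \<notin> ball (g u + R *\<^sub>R l) R"
      using assms(2) l(1) unfolding R_path_def by blast
    then have "R \<le> norm ((g w - g u) - R *\<^sub>R l)"
      by (simp add: dist_norm norm_minus_commute algebra_simps)
    then have "R\<^sup>2 \<le> (norm ((g w - g u) - R *\<^sub>R l))\<^sup>2"
      using assms(1) by (intro power_mono) auto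
    also have "\<dots> = (norm (g w - g u))\<^sup>2 - 2 * R * ((g w - g u) \<bullet> l) + R\<^sup>2 * (l \<bullet> l)"
      unfolding power2_norm_eq_inner inner_diff_left[of "g w - g u"] inner_diff_right[of _ "g w - g u"]
      by (simp add: inner_commute power2_eq_square)
    finally show "2 * R * ((g w - g u) \<bullet> l) \<le> (norm (g w - g u))\<^sup>2"
      using l(1) by (simp add: norm_eq_1)
  qed (use assms in auto)
  show ?thesis
    using loop_constant[of u] assms by simp
qed

section \<open>Factoring through a monotone map\<close>

text \<open>A descent from \<open>s\<close> to \<open>t\<close> yields a level \<open>c\<close>
  attained on both sides of a point where \<open>f\<close> differs from \<open>c\<close>: around
  \<open>s\<close> if \<open>f a < f s\<close>, and otherwise around \<open>t\<close>, because
  \<open>f\<close> must climb again to \<open>f b\<close>.\<close>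

lemma connected_fibres_imp_mono_on:
  fixes f :: "real \<Rightarrow> real"
  assumes cont: "continuous_on {a..b} f" and ends: "f a < f b"
    and fibre: "\<And>s u t. \<lbrakk>a \<le> s; s \<le> u; u \<le> t; t \<le> b; f s = f t\<rbrakk> \<Longrightarrow> f u = f s"
  shows "mono_on {a..b} f"
proof (rule mono_onI, rule ccontr)
  fix s t
  assume s: "s \<in> {a..b}" and t: "t \<in> {a..b}" and "s \<le> t" and "\<not> f s \<le> f t"
  have sub: "continuous_on {p..q} f" if "a \<le> p" "q \<le> b" for p q
    using that by (auto intro: continuous_on_subset[OF cont])
  show False
  proof (cases "f a < f s")
    case True
    define c where "c = max (f a) (f t)"
    have c: "f a \<le> c" "f t \<le> c" "c < f s"
      using True \<open>\<not> f s \<le> f t\<close> unfolding c_def by auto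
    obtain p where "a \<le> p" "p \<le> s" "f p = c"
      using IVT'[of f a c s] sub[of a s] s c by auto
    moreover obtain q where "s \<le> q" "q \<le> t" "f q = c"
      using IVT2'[of f t c s] sub[of s t] s t c \<open>s \<le> t\<close> by auto
    ultimately show False
      using fibre[of p s q] t c by auto
  next
    case False
    define c where "c = min (f s) (f b)"
    have c: "c \<le> f s" "c \<le> f b" "f t < c"
      using False ends \<open>\<not> f s \<le> f t\<close> unfolding c_def by auto
    obtain p where "s \<le> p" "p \<le> t" "f p = c"
      using IVT2'[of f t c s] sub[of s t] s t c \<open>s \<le> t\<close> by auto
    moreover obtain q where "t \<le> q" "q \<le> b" "f q = c"
      using IVT'[of f t c b] sub[of t b] t c by auto
    ultimately show False
      using fibre[of p t q] s c by auto
  qed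
qed

text \<open>A monotone-light factorization: interval fibres make the image homeomorphic to a
  segment. The coordinate along that segment, composed with \<open>g\<close>, gives
  \<open>f\<close>, and the inverse homeomorphism gives \<open>h\<close>.\<close>

lemma monotone_light_path:
  fixes g :: "real \<Rightarrow> 'a::{real_normed_vector,complete_space}"
  assumes "a \<le> b" and cont: "continuous_on {a..b} g" and ends: "g a \<noteq> g b"
    and fibre: "\<And>s u t. \<lbrakk>a \<le> s; s \<le> u; u \<le> t; t \<le> b; g s = g t\<rbrakk> \<Longrightarrow> g u = g s"
  obtains f :: "real \<Rightarrow> real" and h where
    "continuous_on {a..b} f" "mono_on {a..b} f"
    "continuous_on (f ` {a..b}) h" "inj_on h (f ` {a..b})" "\<And>t. t \<in> {a..b} \<Longrightarrow> g t = h (f t)"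
proof -
  have "a < b"
    using assms(1) ends by (cases "a = b") auto
  define k where "k = (\<lambda>x. g (a + (b - a) * x))"
  have affine: "(\<lambda>x. a + (b - a) * x) ` {0..1} = {a..b}"
    using image_affinity_atLeastAtMost[of "b - a" a 0 "1::real"] \<open>a < b\<close> by (simp add: add.commute)
  have img: "k ` {0..1} = g ` {a..b}"
    unfolding k_def affine[symmetric] image_image by simp
  have "k ` {0..1} homeomorphic {0..1::real}"
  proof (rule homeomorphic_monotone_image_interval)
    show "continuous_on {0..1} k"
      unfolding k_def using affine
      by (intro continuous_on_compose2[OF cont] continuous_intros) auto
    show "k 1 \<noteq> k 0"
      unfolding k_def using ends by simp
    have "is_interval ({0..1} \<inter> k -` {y})" for y
      unfolding is_interval_1
    proof (intro ballI allI impI)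
      fix s t u :: real
      assume s: "s \<in> {0..1} \<inter> k -` {y}" and t: "t \<in> {0..1} \<inter> k -` {y}" and "s \<le> u \<and> u \<le> t"
      have "a \<le> a + (b - a) * s" "a + (b - a) * s \<le> a + (b - a) * u"
        "a + (b - a) * u \<le> a + (b - a) * t" "a + (b - a) * t \<le> a + (b - a) * 1"
        using \<open>a < b\<close> s t \<open>s \<le> u \<and> u \<le> t\<close>
        by (simp, (intro add_left_mono mult_left_mono; simp)+)
      moreover have "g (a + (b - a) * s) = g (a + (b - a) * t)"
        using s t unfolding k_def by simp
      ultimately have "k u = k s"
        unfolding k_def using fibre[of "a + (b - a) * s" "a + (b - a) * u" "a + (b - a) * t"] by simp
      then show "u \<in> {0..1} \<inter> k -` {y}"
        using s t \<open>s \<le> u \<and> u \<le> t\<close> by auto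
    qed
    then show "connected ({0..1} \<inter> k -` {y})" for y
      using is_interval_connected by blast
  qed
  then obtain \<phi> \<psi> where hom: "homeomorphism (g ` {a..b}) {0..1::real} \<phi> \<psi>"
    unfolding img homeomorphic_def by blast
  have \<psi>\<phi>: "\<psi> (\<phi> (g t)) = g t" if "t \<in> {a..b}" for t
    using hom that unfolding homeomorphism_def by blast
  have c\<phi>: "continuous_on {a..b} (\<lambda>t. \<phi> (g t))"
    using hom unfolding homeomorphism_def
    by (intro continuous_on_compose2[OF _ cont]) auto
  have \<phi>_img: "(\<lambda>t. \<phi> (g t)) ` {a..b} = {0..1}"
    using hom unfolding homeomorphism_def image_image[symmetric, of \<phi> g] by blast
  \<comment> \<open>The homeomorphism may run along the image in either direction; this sign orients
    it so that \<open>f a < f b\<close>.\<close>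
  define \<sigma> :: real where "\<sigma> = (if \<phi> (g a) < \<phi> (g b) then 1 else - 1)"
  have \<sigma>: "\<sigma> * \<sigma> = 1" "\<And>x. \<sigma> * (\<sigma> * x) = x"
    unfolding \<sigma>_def by auto
  define f where "f = (\<lambda>t. \<sigma> * \<phi> (g t))"
  define h where "h = (\<lambda>x. \<psi> (\<sigma> * x))"
  have gh: "g t = h (f t)" if "t \<in> {a..b}" for t
    unfolding h_def f_def \<sigma> using \<psi>\<phi>[OF that] by simp
  have f_eq: "f s = f t \<longleftrightarrow> g s = g t" if "s \<in> {a..b}" "t \<in> {a..b}" for s t
    using gh that unfolding f_def by metis
  have cf: "continuous_on {a..b} f"
    unfolding f_def by (intro continuous_intros c\<phi>)
  show ?thesis
  proof (rule that[of f h])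
    have "\<phi> (g a) \<noteq> \<phi> (g b)"
      using \<psi>\<phi> ends \<open>a < b\<close> by (metis atLeastAtMost_iff less_eq_real_def)
    then have "f a < f b"
      unfolding f_def \<sigma>_def by auto
    then show "mono_on {a..b} f"
    proof (rule connected_fibres_imp_mono_on[OF cf])
      fix s u t
      assume H: "a \<le> s" "s \<le> u" "u \<le> t" "t \<le> b" "f s = f t"
      then have "g u = g s"
        using fibre[of s u t] f_eq[of s t] by simp
      then show "f u = f s"
        unfolding f_def by simp
    qed
    have c\<psi>: "continuous_on {0..1} \<psi>"
      using hom unfolding homeomorphism_def by blast
    have "(\<lambda>x. \<sigma> * x) ` f ` {a..b} = (\<lambda>t. \<phi> (g t)) ` {a..b}"
      unfolding image_image f_def \<sigma> ..
    then have "(\<lambda>x. \<sigma> * x) ` f ` {a..b} \<subseteq> {0..1}"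
      unfolding \<phi>_img by simp
    then show "continuous_on (f ` {a..b}) h"
      unfolding h_def by (rule continuous_on_compose2[OF c\<psi> continuous_on_mult_left[OF continuous_on_id]])
    show "inj_on h (f ` {a..b})"
    proof (rule inj_onI)
      fix x y
      assume x: "x \<in> f ` {a..b}" and y: "y \<in> f ` {a..b}" and hxy: "h x = h y"
      obtain p where p: "x = f p" "p \<in> {a..b}"
        using x by (rule imageE)
      obtain q where q: "y = f q" "q \<in> {a..b}"
        using y by (rule imageE)
      have "g p = g q"
        using hxy unfolding p(1) q(1) gh[OF p(2), symmetric] gh[OF q(2), symmetric] .
      then show "x = y"
        unfolding p(1) q(1) f_def by (rule arg_cong)
    qed
  qed (use cf gh in auto)
qed

lemma mono_on_image_interval:
  fixes f :: "real \<Rightarrow> real"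
  assumes "continuous_on {a..b} f" "mono_on {a..b} f" "a \<le> b"
  shows "f ` {a..b} = {f a..f b}"
proof
  show "f ` {a..b} \<subseteq> {f a..f b}"
    using mono_onD[OF assms(2)] assms(3) by auto
  show "{f a..f b} \<subseteq> f ` {a..b}"
    using IVT'[of f a _ b] assms(1,3) by fastforce
qed

text \<open>The tangent condition sees a path only through its current point and the images of its
  past and future, and these sets agree for \<open>g\<close> at \<open>t\<close> and
  \<open>h\<close> at \<open>f t\<close>. Any preimage \<open>t\<close> of a parameter of
  \<open>h\<close> will do.\<close>

lemma R_path_reparametrize:
  assumes g: "R_path R a b g"
    and f: "continuous_on {a..b} f" "mono_on {a..b} f"
    and h: "continuous_on {f a..f b} h" and gh: "\<And>t. t \<in> {a..b} \<Longrightarrow> g t = h (f t)"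
  shows "R_path R (f a) (f b) h"
proof -
  have "a \<le> b" "g a \<noteq> g b"
    using g unfolding R_path_def by auto
  have piece: "h ` {f p..f q} = g ` {p..q}" if "a \<le> p" "p \<le> q" "q \<le> b" for p q
  proof -
    have "f ` {p..q} = {f p..f q}"
      using that by (intro mono_on_image_interval continuous_on_subset[OF f(1)] mono_on_subset[OF f(2)]) auto
    then have "h ` {f p..f q} = (\<lambda>t. h (f t)) ` {p..q}"
      by (metis image_image)
    also have "\<dots> = g ` {p..q}"
      using gh that by (intro image_cong) auto
    finally show ?thesis .
  qed
  show ?thesis
    unfolding R_path_def
  proof (intro conjI ballI impI)
    show "f a \<le> f b"
      using mono_onD[OF f(2), of a b] \<open>a \<le> b\<close> by simp
    show "h (f a) \<noteq> h (f b)"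
      using gh \<open>a \<le> b\<close> \<open>g a \<noteq> g b\<close> by simp
    fix \<tau> l
    assume \<tau>: "\<tau> \<in> {f a..f b}"
      and l: "l \<in> uminus ` Tan (h ` {f a..\<tau>}) (h \<tau>) \<union> Tan (h ` {\<tau>..f b}) (h \<tau>)" "norm l = 1"
    obtain t where t: "t \<in> {a..b}" "\<tau> = f t"
      using \<tau> mono_on_image_interval[OF f \<open>a \<le> b\<close>] by blast
    have "h ` {f a..\<tau>} = g ` {a..t}" "h ` {\<tau>..f b} = g ` {t..b}" "h \<tau> = g t"
      using t piece[of a t] piece[of t b] gh by auto
    then show "h ` {f a..\<tau>} \<inter> ball (h \<tau> + R *\<^sub>R l) R = {}"
      using g t(1) l unfolding R_path_def by simp
  qed (rule h)
qed

theorem theorem5p3: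
  fixes R N a b :: real and x\<^sub>0 :: "real^2" and g :: "real \<Rightarrow> real^2"
  assumes "R > 0" and "N > 1"
    and "R_path R a b g"
    and "g ` {a..b} \<subseteq> cball x\<^sub>0 (R / (2 * N))"
  shows "\<exists>(\<alpha>::real) (\<beta>::real) (h :: real \<Rightarrow> real^2) (f :: real \<Rightarrow> real).
           R_path R \<alpha> \<beta> h \<and> inj_on h {\<alpha>..\<beta>} \<and>
           continuous_on {a..b} f \<and> mono_on {a..b} f \<and> f ` {a..b} = {\<alpha>..\<beta>} \<and>
           (\<forall>t\<in>{a..b}. g t = h (f t))"
proof -
  have g: "a \<le> b" "continuous_on {a..b} g" "g a \<noteq> g b"
    using assms(3) unfolding R_path_def by auto
  have fibre: "g u = g s" if "a \<le> s" "s \<le> u" "u \<le> t" "t \<le> b" "g s = g t" for s u t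
    using R_path_constant_between[OF assms(1,3) that] .
  obtain f :: "real \<Rightarrow> real" and h where f: "continuous_on {a..b} f" "mono_on {a..b} f"
    and h: "continuous_on (f ` {a..b}) h" "inj_on h (f ` {a..b})"
    and gh: "\<And>t. t \<in> {a..b} \<Longrightarrow> g t = h (f t)"
    by (rule monotone_light_path[OF g]) (use fibre in blast)+
  have img: "f ` {a..b} = {f a..f b}"
    using mono_on_image_interval[OF f g(1)] .
  then have "R_path R (f a) (f b) h"
    using R_path_reparametrize[OF assms(3) f _ gh] h(1) by simp
  then show ?thesis
    using f h(2) gh img by metis
qed

end
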